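(* Let $I_T$ be a simple toric ideal, where $T$ is an integer matrix with $s$ columns, let $\omega\subseteq[s]$, and let $I_{A_1}$, $I_{A_2}$ be homogeneous $T_\omega$-robust toric ideals without free bouquets. Let $D_1:\ker_{\mathbb{Z}}(T)\to\ker_{\mathbb{Z}}(A_1)$ and $D_2:\ker_{\mathbb{Z}}(T)\to\ker_{\mathbb{Z}}(A_2)$ be the associated bouquet bijections and let $\phi=D_2\circ D_1^{-1}:\ker_{\mathbb{Z}}(A_1)\to\ker_{\mathbb{Z}}(A_2)$. Then for all $\hat z,z\in\ker_{\mathbb{Z}}(A_1)$, $z$ is distance-reduced by $\hat z$ if and only if $\phi(z)$ is distance-reduced by $\phi(\hat z)$.
   Context: For $z\in\mathbb{Z}^n$ write $z=z^+-z^-$ with $z^+_i=\max(z_i,0)$ and $z^-_i=\max(-z_i,0)$. For an integer matrix $A\in\mathbb{Z}^{d\times n}$ and a field $k$, the toric ideal is $I_A=\langle x^{z^+}-x^{z^-} : z\in\ker_{\mathbb{Z}}(A)\rangle\subseteq k[x_1,\dots,x_n]$. Standing assumption: an integer matrix $A$ whose toric ideal is considered satisfies $\ker_{\mathbb{Z}}(A)\cap\mathbb{N}^n=\{0\}$. $A$ (or $I_A$) is homogeneous if $(1,\dots,1)\in\mathbb{Z}^n$ lies in the rational row span of $A$. $[s]=\{1,\dots,s\}$. Bouquets: two column indices $i,j\in[n]$ of $A$ are equivalent if there are nonzero $\alpha,\beta\in\mathbb{Q}$ with $\alpha u_i+\beta u_j=0$ for all $u\in\ker_{\mathbb{Z}}(A)$.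 The equivalence classes $B_1,\dots,B_s$ are the bouquets of $A$. A bouquet $B$ is free if $u_i=0$ for all $i\in B$ and all $u\in\ker_{\mathbb{Z}}(A)$. For a non-free bouquet $B_i$, the bouquet-index-encoding vector $\mathbf{c}_i\in\mathbb{Z}^n$ is the unique integer vector with support exactly $B_i$, relatively prime nonzero entries, positive first nonzero entry, and such that for every $u\in\ker_{\mathbb{Z}}(A)$ the restriction of $u$ to the coordinates in $B_i$ is a multiple of the restriction of $\mathbf{c}_i$. A non-free bouquet $B_i$ is mixed if $\mathbf{c}_i$ has a negative entry, and non-mixed otherwise. The bouquet matrix $A_B$ has columns $A\mathbf{c}_1,\dots,A\mathbf{c}_s$, and $I_{A_B}$ is the bouquet ideal of $A$. A toric ideal $I_T$ is simple if every bouquet of $T$ is a singleton. For a simple toric ideal $I_T\subseteq k[x_1,\dots,x_s]$ and $\omega\subseteq[s]$, a toric ideal $I_A$ is $T_\omega$-robust if its bouquet ideal is $I_T$ (equivalently $\ker_{\mathbb{Z}}(A_B)=\ker_{\mathbb{Z}}(T)$, with bouquets $B_1,\dots,B_s$ numbered accordingly) and $\omega=\{i\in[s] : B_i\text{ is non-mixed}\}$. The associated bouquet bijection is $D:\ker_{\mathbb{Z}}(T)\to\ker_{\mathbb{Z}}(A)$, $u\mapsto u_1\mathbf{c}_1+\dots+u_s\mathbf{c}_s$. Distance reduction: let $\lVert\cdot\rVert$ be the $1$-norm and $\le$ the component-wise order. For $\hat z,z\in\ker_{\mathbb{Z}}(A)$, $z$ is distance-reduced by $\hat z$ if there are signs $\varepsilon,\delta\in\{1,-1\}$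 such that $(\varepsilon\hat z)^+\le(\delta z)^+$ and $\lVert\delta z-\varepsilon\hat z\rVert<\lVert z\rVert$. *)

theory Defs
  imports
    "HOL-Library.Poly_Mapping"
    "HOL-Algebra.Ideal"
    "Jordan_Normal_Form.Matrix_Kernel"
begin

text \<open>Coordinates, columns and bouquets are numbered from 0, so the index set
  of an integer matrix \<open>A\<close> with \<open>n\<close> columns is \<open>{..<n}\<close>. Its integer kernel is
  \<open>mat_kernel A\<close>.\<close>

section \<open>Toric ideals\<close>

definition pos_part :: "int vec \<Rightarrow> int vec" where
  "pos_part z = vec (dim_vec z) (\<lambda>i. max (z $ i) 0)"

definition neg_part :: "int vec \<Rightarrow> int vec" where
  "neg_part z = vec (dim_vec z) (\<lambda>i. max (- (z $ i)) 0)"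

text \<open>Polynomials in the variables \<open>x\<^sub>0, x\<^sub>1, \<dots>\<close> are finitely supported
  functions from exponents to coefficients.\<close>

type_synonym 'k mpoly = "(nat \<Rightarrow>\<^sub>0 nat) \<Rightarrow>\<^sub>0 'k"

definition mvar :: "nat \<Rightarrow> 'k::comm_ring_1 mpoly" where
  "mvar i = Poly_Mapping.single (Poly_Mapping.single i 1) 1"

text \<open>The polynomial ring in the variables \<open>x\<^sub>0, \<dots>, x\<^sub>n\<^sub>-\<^sub>1\<close>.\<close>

definition mpoly_ring :: "nat \<Rightarrow> 'k::comm_ring_1 mpoly ring" where
  "mpoly_ring n =
     \<lparr>carrier = {p. \<forall>m \<in> Poly_Mapping.keys p. Poly_Mapping.keys m \<subseteq> {..<n}},
      mult = (*), one = 1, zero = 0, add = (+)\<rparr>"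

lemma mpoly_ring_cring: "cring (mpoly_ring n :: 'k::comm_ring_1 mpoly ring)"
proof -
  let ?C = "carrier (mpoly_ring n) :: 'k mpoly set"
  have C: "p \<in> ?C \<longleftrightarrow> (\<forall>m \<in> Poly_Mapping.keys p. Poly_Mapping.keys m \<subseteq> {..<n})" for p
    by (simp add: mpoly_ring_def)
  have add: "p + q \<in> ?C" if "p \<in> ?C" "q \<in> ?C" for p q
    using that Poly_Mapping.keys_add[of p q] unfolding C by blast
  have mult: "p * q \<in> ?C" if p: "p \<in> ?C" and q: "q \<in> ?C" for p q
    unfolding C
  proof
    fix m assume "m \<in> Poly_Mapping.keys (p * q)"
    with keys_mult[of p q] obtain a b where
      m: "m = a + b" "a \<in> Poly_Mapping.keys p" "b \<in> Poly_Mapping.keys q" by blast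
    then have "Poly_Mapping.keys a \<subseteq> {..<n}" "Poly_Mapping.keys b \<subseteq> {..<n}"
      using p q unfolding C by blast+
    then show "Poly_Mapping.keys m \<subseteq> {..<n}"
      using Poly_Mapping.keys_add[of a b] unfolding m(1) by blast
  qed
  have uminus: "- p \<in> ?C" if "p \<in> ?C" for p
    using that unfolding C by simp
  have zero: "0 \<in> ?C" and one: "1 \<in> ?C"
    unfolding C by simp_all
  have ops: "mult (mpoly_ring n) = ((*) :: 'k mpoly \<Rightarrow> _)" "add (mpoly_ring n) = ((+) :: 'k mpoly \<Rightarrow> _)"
    "one (mpoly_ring n) = (1 :: 'k mpoly)" "ring.zero (mpoly_ring n) = (0 :: 'k mpoly)"
    by (simp_all add: mpoly_ring_def)
  show ?thesis
  proof (rule cringI)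
    show "abelian_group (mpoly_ring n :: 'k mpoly ring)"
      by (rule abelian_groupI; unfold ops)
         (auto intro: add zero uminus add.assoc add.commute left_minus)
    show "Group.comm_monoid (mpoly_ring n :: 'k mpoly ring)"
      by (rule comm_monoidI; unfold ops) (auto intro: mult one mult.assoc mult.commute)
  qed (simp add: ops distrib_right)
qed

text \<open>The monomial \<open>x\<^sup>v\<close>; only used for \<open>v \<ge> 0\<close>.\<close>

definition mpow :: "int vec \<Rightarrow> 'k::comm_ring_1 mpoly" where
  "mpow v = (\<Prod>i<dim_vec v. mvar i ^ nat (v $ i))"

definition toric_ideal :: "int mat \<Rightarrow> 'k::field mpoly set" where
  "toric_ideal A =
     genideal (mpoly_ring (dim_col A))
       {mpow (pos_part z) - mpow (neg_part z) | z. z \<in> mat_kernel A}"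

text \<open>The standing assumption on matrices whose toric ideal is considered.\<close>

definition pointed :: "int mat \<Rightarrow> bool" where
  "pointed A \<longleftrightarrow>
     mat_kernel A \<inter> {v \<in> carrier_vec (dim_col A). 0\<^sub>v (dim_col A) \<le> v} = {0\<^sub>v (dim_col A)}"

definition homogeneous :: "int mat \<Rightarrow> bool" where
  "homogeneous A \<longleftrightarrow>
     vec (dim_col A) (\<lambda>_. 1) \<in> vec_space.row_space (dim_col A) (map_mat rat_of_int A)"

section \<open>Bouquets\<close>

definition bouquet_rel :: "int mat \<Rightarrow> (nat \<times> nat) set" where
  "bouquet_rel A =
     {(i, j). i < dim_col A \<and> j < dim_col A \<and>
        (\<exists>\<alpha> \<beta> :: rat. \<alpha> \<noteq> 0 \<and> \<beta> \<noteq> 0 \<and>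
           (\<forall>u \<in> mat_kernel A. \<alpha> * of_int (u $ i) + \<beta> * of_int (u $ j) = 0))}"

definition bouquets :: "int mat \<Rightarrow> nat set set" where
  "bouquets A = {..<dim_col A} // bouquet_rel A"

definition free_bouquet :: "int mat \<Rightarrow> nat set \<Rightarrow> bool" where
  "free_bouquet A B \<longleftrightarrow> (\<forall>i \<in> B. \<forall>u \<in> mat_kernel A. u $ i = 0)"

text \<open>The bouquet-index-encoding vector of a non-free bouquet \<open>B\<close>. For a free
  bouquet the description is not unique and the value is meaningless.\<close>

definition bouquet_vec :: "int mat \<Rightarrow> nat set \<Rightarrow> int vec" where
  "bouquet_vec A B =
     (THE c. c \<in> carrier_vec (dim_col A) \<and>
        {i. i < dim_col A \<and> c $ i \<noteq> 0} = B \<and>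
        Gcd ((\<lambda>i. c $ i) ` B) = 1 \<and>
        c $ Min B > 0 \<and>
        (\<forall>u \<in> mat_kernel A. \<exists>m::int. \<forall>i \<in> B. u $ i = m * c $ i))"

definition mixed :: "int mat \<Rightarrow> nat set \<Rightarrow> bool" where
  "mixed A B \<longleftrightarrow> \<not> free_bouquet A B \<and> (\<exists>i<dim_col A. bouquet_vec A B $ i < 0)"

definition non_mixed :: "int mat \<Rightarrow> nat set \<Rightarrow> bool" where
  "non_mixed A B \<longleftrightarrow> \<not> free_bouquet A B \<and> \<not> mixed A B"

definition simple_toric :: "int mat \<Rightarrow> bool" where
  "simple_toric T \<longleftrightarrow> (\<forall>B \<in> bouquets T. is_singleton B)"

text \<open>In the following, \<open>B 0, \<dots>, B (s - 1)\<close> is a numbering of the bouquets of \<open>A\<close>.\<close>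

definition bouquet_matrix :: "int mat \<Rightarrow> nat \<Rightarrow> (nat \<Rightarrow> nat set) \<Rightarrow> int mat" where
  "bouquet_matrix A s B =
     mat_of_cols (dim_row A) (map (\<lambda>i. A *\<^sub>v bouquet_vec A (B i)) [0..<s])"

text \<open>\<open>I\<^sub>A\<close> is \<open>T\<^sub>\<omega>\<close>-robust, as witnessed by the numbering \<open>B\<close> of the bouquets of \<open>A\<close>.
  The numbering is an explicit argument because the bouquet bijection depends on it.
  The first argument fixes the coefficient field of the toric ideals.\<close>

definition robust :: "'k::field itself \<Rightarrow> int mat \<Rightarrow> nat set \<Rightarrow> int mat \<Rightarrow> (nat \<Rightarrow> nat set) \<Rightarrow> bool" where
  "robust _ T \<omega> A B \<longleftrightarrow>
     bij_betw B {..<dim_col T} (bouquets A) \<and>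
     (toric_ideal (bouquet_matrix A (dim_col T) B) :: 'k mpoly set) = toric_ideal T \<and>
     \<omega> = {i. i < dim_col T \<and> non_mixed A (B i)}"

definition bouquet_map :: "int mat \<Rightarrow> (nat \<Rightarrow> nat set) \<Rightarrow> int vec \<Rightarrow> int vec" where
  "bouquet_map A B u =
     vec (dim_col A) (\<lambda>j. \<Sum>i<dim_vec u. u $ i * bouquet_vec A (B i) $ j)"

section \<open>Distance reduction\<close>

definition norm1 :: "int vec \<Rightarrow> int" where
  "norm1 v = (\<Sum>i<dim_vec v. \<bar>v $ i\<bar>)"

text \<open>\<open>z\<close> is distance-reduced by \<open>zh\<close>.\<close>

definition distance_reduced_by :: "int vec \<Rightarrow> int vec \<Rightarrow> bool" where
  "distance_reduced_by z zh \<longleftrightarrow>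
     (\<exists>\<epsilon> \<in> {1, -1}. \<exists>\<delta> \<in> {1, -1}.
        pos_part (\<epsilon> \<cdot>\<^sub>v zh) \<le> pos_part (\<delta> \<cdot>\<^sub>v z) \<and>
        norm1 (\<delta> \<cdot>\<^sub>v z - \<epsilon> \<cdot>\<^sub>v zh) < norm1 z)"

end

theory Submission
  imports Defs
begin

text \<open>Write kernel vectors of \<open>A\<close> in bouquet coordinates: the bouquet bijection \<open>D\<close> multiplies
  the encoding vector of the \<open>i\<close>-th bouquet by the \<open>i\<close>-th coordinate. The sizes of the encoding
  vectors enter the norms in the definition of distance reduction, so two matrices with the same
  bouquet ideal seem to give different conditions. Homogeneity removes the sizes. It makes the
  entries of every kernel vector sum to zero, so that the 1-norm is twice the total of the
  negative part; and if the positive part of \<open>zh\<close> is at most that of \<open>z\<close>, then subtracting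
  \<open>zh\<close> shortens \<open>z\<close> if and only if some index has \<open>z\<close> and \<open>zh\<close> both negative
  (\<open>norm1_diff_less_iff\<close>).

  What remains are comparisons, index by index, of multiples of one entry of an encoding vector.
  They depend only on the sign of that entry. Every encoding vector has a positive entry, and it
  has a negative one if and only if its bouquet is mixed, that is, if its number is not in
  \<open>\<omega>\<close>. So distance reduction is a condition on the bouquet coordinates and \<open>\<omega>\<close> alone
  (\<open>distance_reduced_by_D_iff\<close>), and it is the same for both matrices.

  The coordinates of both matrices range over the kernel of \<open>T\<close>. For this, an equality of toric
  ideals has to be turned into an equality of kernels (\<open>toric_ideal_eq_imp_mat_kernel_eq\<close>), and
  \<open>D\<close> has to be a bijection from the kernel of the bouquet matrix to that of \<open>A\<close>
  (\<open>bij_betw_D\<close>), which rests on the existence and uniqueness of encoding vectors.\<close>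

section \<open>The binomials in a toric ideal\<close>

lemma poly_mapping_eq_sum_single:
  "p = (\<Sum>m\<in>Poly_Mapping.keys p. Poly_Mapping.single m (Poly_Mapping.lookup p m))"
  by (rule poly_mapping_eqI)
     (auto simp: lookup_sum lookup_single when_def in_keys_iff)

text \<open>The linear map that sends the monomial with exponent \<open>m\<close> to the one with exponent
  \<open>h m\<close>. For additive \<open>h\<close> it is a ring homomorphism; for integer-valued \<open>h\<close> its target is the
  ring of Laurent polynomials in one variable, and its kernel consists of the polynomials whose
  coefficients sum to zero in each degree with respect to \<open>h\<close>.\<close>

definition push_exponents :: "('a \<Rightarrow> 'b) \<Rightarrow> ('a \<Rightarrow>\<^sub>0 'k::comm_ring_1) \<Rightarrow> ('b \<Rightarrow>\<^sub>0 'k)" where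
  "push_exponents h p =
     (\<Sum>m\<in>Poly_Mapping.keys p. Poly_Mapping.single (h m) (Poly_Mapping.lookup p m))"

lemma push_exponents_superset:
  assumes "finite S" "Poly_Mapping.keys p \<subseteq> S"
  shows "push_exponents h p = (\<Sum>m\<in>S. Poly_Mapping.single (h m) (Poly_Mapping.lookup p m))"
  unfolding push_exponents_def
  by (rule sum.mono_neutral_left) (use assms in \<open>auto simp: in_keys_iff\<close>)

lemma push_exponents_zero [simp]: "push_exponents h 0 = 0"
  by (simp add: push_exponents_def)

lemma push_exponents_add: "push_exponents h (p + q) = push_exponents h p + push_exponents h q"
proof -
  let ?S = "Poly_Mapping.keys p \<union> Poly_Mapping.keys q"
  have "Poly_Mapping.keys (p + q) \<subseteq> ?S"
    by (rule Poly_Mapping.keys_add)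
  then show ?thesis
    by (simp add: push_exponents_superset[of ?S] lookup_add single_add sum.distrib)
qed

lemma push_exponents_single [simp]:
  "push_exponents h (Poly_Mapping.single m c) = Poly_Mapping.single (h m) c"
  by (simp add: push_exponents_superset[of "{m}"])

lemma push_exponents_diff: "push_exponents h (p - q) = push_exponents h p - push_exponents h q"
  using push_exponents_add[of h "p - q" q] by simp

lemma push_exponents_sum: "push_exponents h (sum f S) = (\<Sum>x\<in>S. push_exponents h (f x))"
  by (induction S rule: infinite_finite_induct) (simp_all add: push_exponents_add)

lemma push_exponents_mult:
  fixes h :: "'a::monoid_add \<Rightarrow> 'b::monoid_add"
  assumes "\<And>a b. h (a + b) = h a + h b"
  shows "push_exponents h (p * q) = push_exponents h p * push_exponents h q"
proof -
  have "p * q = (\<Sum>a\<in>Poly_Mapping.keys p. \<Sum>b\<in>Poly_Mapping.keys q.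
      Poly_Mapping.single (a + b) (Poly_Mapping.lookup p a * Poly_Mapping.lookup q b))"
    by (subst poly_mapping_eq_sum_single[of p], subst poly_mapping_eq_sum_single[of q])
       (simp add: sum_product mult_single)
  then show ?thesis
    by (simp add: push_exponents_sum assms)
       (simp add: push_exponents_def sum_product mult_single)
qed

definition vec_exponent :: "int vec \<Rightarrow> (nat \<Rightarrow>\<^sub>0 nat)" where
  "vec_exponent v = (\<Sum>i<dim_vec v. Poly_Mapping.single i (nat (v $ i)))"

lemma lookup_vec_exponent:
  "Poly_Mapping.lookup (vec_exponent v) i = (if i < dim_vec v then nat (v $ i) else 0)"
  by (auto simp: vec_exponent_def lookup_sum lookup_single when_def)

lemma mvar_power: "(mvar i :: 'k::comm_ring_1 mpoly) ^ k = Poly_Mapping.single (Poly_Mapping.single i k) 1"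
  by (induction k) (simp_all add: mvar_def mult_single single_add[symmetric] add.commute)

lemma mpow_eq_single: "(mpow v :: 'k::comm_ring_1 mpoly) = Poly_Mapping.single (vec_exponent v) 1"
proof -
  have "(\<Prod>i<n. (mvar i :: 'k mpoly) ^ f i)
      = Poly_Mapping.single (\<Sum>i<n. Poly_Mapping.single i (f i)) 1" for n :: nat and f
    by (induction n) (simp_all add: mvar_power mult_single add.commute)
  then show ?thesis
    by (simp add: mpow_def vec_exponent_def)
qed

lemma mpow_in_carrier: "mpow v \<in> carrier (mpoly_ring (dim_vec v))"
  by (auto simp: mpow_eq_single mpoly_ring_def in_keys_iff lookup_vec_exponent split: if_splits)

lemma diff_in_carrier:
  "p \<in> carrier (mpoly_ring n) \<Longrightarrow> q \<in> carrier (mpoly_ring n) \<Longrightarrow> p - q \<in> carrier (mpoly_ring n)"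
  using Poly_Mapping.keys_diff[of p q] by (fastforce simp: mpoly_ring_def)

lemma dim_pos_part [simp]: "dim_vec (pos_part z) = dim_vec z"
  and dim_neg_part [simp]: "dim_vec (neg_part z) = dim_vec z"
  by (simp_all add: pos_part_def neg_part_def)

lemma ideal_kernel_push:
  fixes h :: "(nat \<Rightarrow>\<^sub>0 nat) \<Rightarrow> int"
  assumes h: "\<And>a b. h (a + b) = h a + h b"
  shows "ideal {p \<in> carrier (mpoly_ring n :: 'k::comm_ring_1 mpoly ring). push_exponents h p = 0}
    (mpoly_ring n)"
proof -
  interpret R: cring "mpoly_ring n :: 'k mpoly ring" by (rule mpoly_ring_cring)
  have ops: "mult (mpoly_ring n) = ((*) :: 'k mpoly \<Rightarrow> _)" "add (mpoly_ring n) = ((+) :: 'k mpoly \<Rightarrow> _)"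
    "ring.zero (mpoly_ring n) = (0 :: 'k mpoly)"
    by (simp_all add: mpoly_ring_def)
  have neg: "\<ominus>\<^bsub>mpoly_ring n\<^esub> p = - p" if "p \<in> carrier (mpoly_ring n)" for p :: "'k mpoly"
    using R.l_neg[OF that] unfolding ops by (simp add: eq_neg_iff_add_eq_0)
  show ?thesis
  proof (rule idealI)
    show "ring (mpoly_ring n :: 'k mpoly ring)" by (rule R.ring_axioms)
    show "subgroup {p \<in> carrier (mpoly_ring n :: 'k mpoly ring). push_exponents h p = 0}
        (add_monoid (mpoly_ring n))"
    proof (rule R.add.subgroupI)
      fix p assume p: "p \<in> {p \<in> carrier (mpoly_ring n :: 'k mpoly ring). push_exponents h p = 0}"
      then have "push_exponents h (0 - p) = 0"
        by (subst push_exponents_diff) simp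
      then show "\<ominus>\<^bsub>mpoly_ring n\<^esub> p \<in> {p \<in> carrier (mpoly_ring n). push_exponents h p = 0}"
        using p R.a_inv_closed[of p] by (simp add: neg)
    next
      show "{p \<in> carrier (mpoly_ring n :: 'k mpoly ring). push_exponents h p = 0} \<noteq> {}"
        using R.zero_closed unfolding ops by force
    next
      fix p q
      assume "p \<in> {p \<in> carrier (mpoly_ring n :: 'k mpoly ring). push_exponents h p = 0}"
        "q \<in> {p \<in> carrier (mpoly_ring n :: 'k mpoly ring). push_exponents h p = 0}"
      then show "p \<oplus>\<^bsub>mpoly_ring n\<^esub> q \<in> {p \<in> carrier (mpoly_ring n). push_exponents h p = 0}"
        using R.a_closed[of p q] by (simp add: ops push_exponents_add)
    qed auto
  next
    fix p x :: "'k mpoly"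
    assume "p \<in> {p \<in> carrier (mpoly_ring n :: 'k mpoly ring). push_exponents h p = 0}"
      and "x \<in> carrier (mpoly_ring n)"
    then show "x \<otimes>\<^bsub>mpoly_ring n\<^esub> p \<in> {p \<in> carrier (mpoly_ring n). push_exponents h p = 0}"
      and "p \<otimes>\<^bsub>mpoly_ring n\<^esub> x \<in> {p \<in> carrier (mpoly_ring n). push_exponents h p = 0}"
      using R.m_closed[of p x] R.m_closed[of x p]
      by (simp_all add: ops push_exponents_mult[OF h])
  qed
qed

text \<open>A row \<open>a\<close> of \<open>A\<close> gives a substitution that replaces the \<open>j\<close>-th variable by the power of a
  single Laurent variable \<open>t\<close> whose exponent is the \<open>j\<close>-th entry of \<open>a\<close>. The monomial with
  exponent vector \<open>v\<close> becomes \<open>t\<close> to the power \<open>a \<bullet> v\<close>. So the substitution kills every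
  generator of the toric ideal, hence the whole ideal; and if it kills the binomial of \<open>z\<close>, then
  both monomials have the same power of \<open>t\<close>, that is, \<open>a \<bullet> z = 0\<close>. Letting \<open>a\<close> run through the
  rows puts \<open>z\<close> in the kernel.\<close>

lemma binomial_in_toric_ideal_iff:
  assumes z: "z \<in> carrier_vec (dim_col A)"
  shows "mpow (pos_part z) - mpow (neg_part z) \<in> (toric_ideal A :: 'k::field mpoly set)
    \<longleftrightarrow> z \<in> mat_kernel A"
proof
  let ?R = "mpoly_ring (dim_col A) :: 'k mpoly ring"
  interpret R: cring ?R by (rule mpoly_ring_cring)
  let ?G = "{mpow (pos_part z) - mpow (neg_part z) | z. z \<in> mat_kernel A} :: 'k mpoly set"
  have G: "?G \<subseteq> carrier ?R"
  proof
    fix p assume "p \<in> ?G"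
    then obtain w where "p = mpow (pos_part w) - mpow (neg_part w)" "dim_vec w = dim_col A"
      by (auto simp: mat_kernel_def)
    then show "p \<in> carrier ?R"
      using mpow_in_carrier[of "pos_part w"] mpow_in_carrier[of "neg_part w"]
      by (auto intro: diff_in_carrier)
  qed
  show "mpow (pos_part z) - mpow (neg_part z) \<in> (toric_ideal A :: 'k mpoly set)"
    if "z \<in> mat_kernel A"
    using that R.genideal_self[OF G] by (auto simp: toric_ideal_def)
  assume *: "mpow (pos_part z) - mpow (neg_part z) \<in> (toric_ideal A :: 'k mpoly set)"
  have "row A r \<bullet> z = 0" if r: "r < dim_row A" for r
  proof -
    define h :: "(nat \<Rightarrow>\<^sub>0 nat) \<Rightarrow> int" where
      "h m = (\<Sum>j<dim_col A. A $$ (r, j) * int (Poly_Mapping.lookup m j))" for m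
    have h: "h (a + b) = h a + h b" for a b
      by (simp add: h_def lookup_add algebra_simps sum.distrib)
    have weight: "h (vec_exponent (pos_part w)) - h (vec_exponent (neg_part w)) = row A r \<bullet> w"
      if "w \<in> carrier_vec (dim_col A)" for w
    proof -
      have "h (vec_exponent (pos_part w)) - h (vec_exponent (neg_part w))
          = (\<Sum>j<dim_col A. A $$ (r, j) * w $ j)"
        unfolding h_def sum_subtractf[symmetric]
      proof (rule sum.cong, simp)
        fix j assume "j \<in> {..<dim_col A}"
        then show "A $$ (r, j) * int (Poly_Mapping.lookup (vec_exponent (pos_part w)) j) -
            A $$ (r, j) * int (Poly_Mapping.lookup (vec_exponent (neg_part w)) j) = A $$ (r, j) * w $ j"
          using that
          by (auto simp: lookup_vec_exponent pos_part_def neg_part_def max_def simp flip: right_diff_distrib)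
      qed
      also have "\<dots> = row A r \<bullet> w"
        using that r by (simp add: scalar_prod_def atLeast0LessThan)
      finally show ?thesis .
    qed
    let ?J = "{p \<in> carrier ?R. push_exponents h p = 0}"
    have "?G \<subseteq> ?J"
    proof
      fix p assume p: "p \<in> ?G"
      then obtain w where pw: "p = mpow (pos_part w) - mpow (neg_part w)" and w: "w \<in> mat_kernel A"
        by auto
      have "row A r \<bullet> w = 0"
        using w r index_mult_mat_vec[of r A w] by (simp add: mat_kernel_def)
      then have "push_exponents h p = 0"
        using weight[of w] w by (simp add: pw push_exponents_diff mpow_eq_single mat_kernel_def)
      then show "p \<in> ?J" using p G by blast
    qed
    then have "toric_ideal A \<subseteq> ?J"
      unfolding toric_ideal_def by (rule R.genideal_minimal[OF ideal_kernel_push[OF h]])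
    then have "push_exponents h (mpow (pos_part z) - mpow (neg_part z) :: 'k mpoly) = 0"
      using * by blast
    then have "Poly_Mapping.single (h (vec_exponent (pos_part z))) (1::'k)
        = Poly_Mapping.single (h (vec_exponent (neg_part z))) 1"
      by (simp add: push_exponents_diff mpow_eq_single)
    then have "h (vec_exponent (pos_part z)) = h (vec_exponent (neg_part z))"
      by (metis lookup_single_eq lookup_single_not_eq zero_neq_one)
    then show ?thesis using weight[OF z] by simp
  qed
  then show "z \<in> mat_kernel A"
    using z by (auto simp: mat_kernel_def intro!: eq_vecI)
qed

text \<open>A bouquet ideal is prescribed as an ideal; this recovers the lattice that the bouquet
  bijection lives on.\<close>

lemma toric_ideal_eq_imp_mat_kernel_eq:
  assumes "(toric_ideal A :: 'k::field mpoly set) = toric_ideal B" "dim_col A = dim_col B"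
  shows "mat_kernel A = mat_kernel B"
proof -
  have "z \<in> mat_kernel A \<longleftrightarrow> z \<in> mat_kernel B" if "z \<in> carrier_vec (dim_col A)" for z
    using binomial_in_toric_ideal_iff[of z A, where ?'k='k]
      binomial_in_toric_ideal_iff[of z B, where ?'k='k] that assms by simp
  then show ?thesis
    using assms(2) by (auto simp: mat_kernel_def)
qed

section \<open>Bouquets and their encoding vectors\<close>

lemma equiv_bouquet_rel: "equiv {..<dim_col A} (bouquet_rel A)"
proof (rule equivI)
  show "bouquet_rel A \<subseteq> {..<dim_col A} \<times> {..<dim_col A}"
    by (auto simp: bouquet_rel_def)
  have "(i, i) \<in> bouquet_rel A" if "i < dim_col A" for i
    unfolding bouquet_rel_def using that
    by simp (rule exI[of _ "1::rat"], simp, rule exI[of _ "-1::rat"], simp)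
  then show "refl_on {..<dim_col A} (bouquet_rel A)"
    by (auto simp: refl_on_def)
  show "sym (bouquet_rel A)"
  proof (rule symI)
    fix i j assume "(i, j) \<in> bouquet_rel A"
    then obtain \<alpha> \<beta> :: rat where "i < dim_col A" "j < dim_col A" "\<alpha> \<noteq> 0" "\<beta> \<noteq> 0"
      "\<forall>u\<in>mat_kernel A. \<beta> * of_int (u $ j) + \<alpha> * of_int (u $ i) = 0"
      by (auto simp: bouquet_rel_def add.commute)
    then show "(j, i) \<in> bouquet_rel A"
      unfolding bouquet_rel_def by blast
  qed
  show "trans (bouquet_rel A)"
  proof (rule transI)
    fix i j k assume "(i, j) \<in> bouquet_rel A" "(j, k) \<in> bouquet_rel A"
    then obtain \<alpha> \<beta> \<gamma> \<delta> :: rat where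
      b: "i < dim_col A" "k < dim_col A" and nz: "\<alpha> \<noteq> 0" "\<beta> \<noteq> 0" "\<gamma> \<noteq> 0" "\<delta> \<noteq> 0" and
      e: "\<forall>u\<in>mat_kernel A. \<alpha> * of_int (u $ i) + \<beta> * of_int (u $ j) = 0"
         "\<forall>u\<in>mat_kernel A. \<gamma> * of_int (u $ j) + \<delta> * of_int (u $ k) = 0"
      by (auto simp: bouquet_rel_def)
    have "(\<gamma> * \<alpha>) * of_int (u $ i) + (- \<beta> * \<delta>) * of_int (u $ k) = 0" if "u \<in> mat_kernel A" for u
    proof -
      have "(\<gamma> * \<alpha>) * of_int (u $ i) + (- \<beta> * \<delta>) * of_int (u $ k)
          = \<gamma> * (\<alpha> * of_int (u $ i) + \<beta> * of_int (u $ j)) - \<beta> * (\<gamma> * of_int (u $ j) + \<delta> * of_int (u $ k))"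
        by (simp add: algebra_simps)
      then show ?thesis using e that by simp
    qed
    moreover have "\<gamma> * \<alpha> \<noteq> 0" "- \<beta> * \<delta> \<noteq> 0" using nz by auto
    ultimately show "(i, k) \<in> bouquet_rel A"
      unfolding bouquet_rel_def using b by blast
  qed
qed

lemma bouquet_subset: "B \<in> bouquets A \<Longrightarrow> B \<subseteq> {..<dim_col A}"
  unfolding bouquets_def using Union_quotient[OF equiv_bouquet_rel] by blast

lemma bouquet_proportional:
  assumes "B \<in> bouquets A" "i \<in> B" "j \<in> B"
  obtains q :: rat where "q \<noteq> 0" "\<And>u. u \<in> mat_kernel A \<Longrightarrow> of_int (u $ i) = q * of_int (u $ j)"
proof -
  have "(i, j) \<in> bouquet_rel A"
    using assms quotient_eq_iff[OF equiv_bouquet_rel, of B A B i j] by (auto simp: bouquets_def)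
  then obtain \<alpha> \<beta> :: rat where "\<alpha> \<noteq> 0" "\<beta> \<noteq> 0"
    and e: "\<forall>u\<in>mat_kernel A. \<alpha> * of_int (u $ i) + \<beta> * of_int (u $ j) = 0"
    by (auto simp: bouquet_rel_def)
  then show ?thesis
    by (intro that[of "- \<beta> / \<alpha>"]) (auto simp: field_simps eq_neg_iff_add_eq_0)
qed

lemma bouquet_cross:
  assumes "B \<in> bouquets A" "i \<in> B" "j \<in> B" "u \<in> mat_kernel A" "v \<in> mat_kernel A"
  shows "u $ i * v $ j = u $ j * v $ i"
proof -
  obtain q :: rat where "\<And>u. u \<in> mat_kernel A \<Longrightarrow> of_int (u $ i) = q * of_int (u $ j)"
    using bouquet_proportional[OF assms(1-3)] by metis
  then have "rat_of_int (u $ i * v $ j) = rat_of_int (u $ j * v $ i)"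
    using assms(4,5) by simp
  then show ?thesis by (simp only: of_int_eq_iff)
qed

text \<open>The property that \<^const>\<open>bouquet_vec\<close> selects by a definite description, named so that
  existence and uniqueness can be stated.\<close>

definition encodes :: "int mat \<Rightarrow> nat set \<Rightarrow> int vec \<Rightarrow> bool" where
  "encodes A B c \<longleftrightarrow> c \<in> carrier_vec (dim_col A) \<and>
     {i. i < dim_col A \<and> c $ i \<noteq> 0} = B \<and>
     Gcd ((\<lambda>i. c $ i) ` B) = 1 \<and>
     c $ Min B > 0 \<and>
     (\<forall>u \<in> mat_kernel A. \<exists>m::int. \<forall>i \<in> B. u $ i = m * c $ i)"

lemma Gcd_image_mult: "Gcd ((\<lambda>i. m * f i) ` B) = \<bar>m :: int\<bar> * Gcd (f ` B)"
proof -
  have "Gcd ((\<lambda>i. m * f i) ` B) = Gcd ((*) m ` (f ` B))"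
    by (simp add: image_image)
  also have "\<dots> = normalize (m * Gcd (f ` B))" by (rule Gcd_mult)
  also have "\<dots> = \<bar>m\<bar> * Gcd (f ` B)" by (simp add: abs_mult)
  finally show ?thesis .
qed

text \<open>A vector proportional to a primitive vector is an integer multiple of it: by the hypothesis
  \<open>c i\<close> divides all entries of \<open>v i \<cdot> c\<close>, whose greatest common divisor is \<open>\<bar>v i\<bar>\<close>, so
  \<open>v i / c i\<close> is an integer.\<close>

lemma multiple_of_primitive:
  fixes c v :: "'a \<Rightarrow> int"
  assumes "Gcd (c ` B) = 1" "i \<in> B" "c i \<noteq> 0" "\<And>j. j \<in> B \<Longrightarrow> c i * v j = v i * c j"
  obtains m where "\<And>j. j \<in> B \<Longrightarrow> v j = m * c j"
proof -
  have "c i dvd Gcd ((\<lambda>j. v i * c j) ` B)"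
    using assms(4) by (auto simp: dvd_Gcd_iff simp flip: assms(4))
  then have "c i dvd v i"
    by (simp add: Gcd_image_mult assms(1))
  then obtain m where m: "v i = c i * m" ..
  have "v j = m * c j" if "j \<in> B" for j
    using assms(3) assms(4)[OF that] by (simp add: m)
  then show ?thesis by (rule that)
qed

text \<open>Some kernel vector is nonzero at one index of \<open>B\<close>, hence at all of them. Its restriction to
  \<open>B\<close>, divided by the gcd of the entries and with the sign normalised, is the encoding vector.\<close>

lemma encodes_exists:
  assumes B: "B \<in> bouquets A" and nonfree: "\<not> free_bouquet A B"
  shows "\<exists>c. encodes A B c"
proof -
  obtain k u where k: "k \<in> B" and u: "u \<in> mat_kernel A" and uk: "u $ k \<noteq> 0"
    using nonfree by (auto simp: free_bouquet_def)
  note sub = bouquet_subset[OF B]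
  have fin: "finite B" using sub finite_subset by blast
  have u_nz: "u $ j \<noteq> 0" if j: "j \<in> B" for j
  proof -
    obtain q :: rat where "\<And>w. w \<in> mat_kernel A \<Longrightarrow> of_int (w $ k) = q * of_int (w $ j)"
      using bouquet_proportional[OF B k j] by metis
    from this[OF u] uk show ?thesis by auto
  qed
  have Min_B: "Min B \<in> B" using fin k by (intro Min_in) auto
  \<comment> \<open>The sign makes the entry of the quotient at the first index positive.\<close>
  define g where "g = sgn (u $ Min B) * Gcd ((\<lambda>i. u $ i) ` B)"
  have "Gcd ((\<lambda>i. u $ i) ` B) \<noteq> 0" using uk k by auto
  then have Gcd_pos: "Gcd ((\<lambda>i. u $ i) ` B) > 0"
    using Gcd_int_greater_eq_0[of "(\<lambda>i. u $ i) ` B"] by linarith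
  then have g_nz: "g \<noteq> 0" using u_nz[OF Min_B] unfolding g_def by (metis less_irrefl mult_eq_0_iff sgn_0_0)
  have g_dvd: "g dvd u $ i" if "i \<in> B" for i
    using that u_nz[OF Min_B] unfolding g_def sgn_if by auto
  define c where "c = vec (dim_col A) (\<lambda>i. if i \<in> B then u $ i div g else 0)"
  have c_u: "u $ i = g * c $ i" if "i \<in> B" for i
    using that sub g_dvd[OF that] by (auto simp: c_def)
  have c_nz: "c $ i \<noteq> 0" if "i \<in> B" for i
    using c_u[OF that] u_nz[OF that] by auto
  have "(\<lambda>i. u $ i) ` B = (\<lambda>i. g * c $ i) ` B"
    by (rule image_cong) (simp_all add: c_u)
  then have "Gcd ((\<lambda>i. u $ i) ` B) = \<bar>g\<bar> * Gcd ((\<lambda>i. c $ i) ` B)"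
    using Gcd_image_mult[of g "\<lambda>i. c $ i" B] by simp
  moreover have "\<bar>g\<bar> = Gcd ((\<lambda>i. u $ i) ` B)"
    using u_nz[OF Min_B] Gcd_pos by (simp add: g_def abs_mult sgn_if)
  ultimately have Gcd_c: "Gcd ((\<lambda>i. c $ i) ` B) = 1"
    using Gcd_pos by (metis less_irrefl mult.right_neutral mult_cancel_left)
  have pos: "c $ Min B > 0"
  proof -
    have "sgn (u $ Min B) = sgn g * sgn (c $ Min B)"
      using c_u[OF Min_B] by (simp add: sgn_mult)
    moreover have "sgn g = sgn (u $ Min B)"
      using Gcd_pos by (simp add: g_def sgn_mult)
    ultimately show ?thesis
      using g_nz c_nz[OF Min_B] by (auto simp: sgn_if split: if_splits)
  qed
  have mult: "\<exists>m::int. \<forall>i\<in>B. v $ i = m * c $ i" if v: "v \<in> mat_kernel A" for v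
  proof -
    have "c $ k * v $ j = v $ k * c $ j" if "j \<in> B" for j
    proof -
      have "g * (c $ k * v $ j) = g * (v $ k * c $ j)"
        using bouquet_cross[OF B k that u v] c_u[OF k] c_u[OF that] by (simp add: ac_simps)
      then show ?thesis using g_nz by simp
    qed
    then obtain m where "\<And>j. j \<in> B \<Longrightarrow> v $ j = m * c $ j"
      using multiple_of_primitive[of "\<lambda>i. c $ i" B k "\<lambda>i. v $ i"] Gcd_c k c_nz[OF k] by blast
    then show ?thesis by blast
  qed
  have "{i. i < dim_col A \<and> c $ i \<noteq> 0} = B"
    using c_nz sub by (auto simp: c_def split: if_splits)
  then show ?thesis
    unfolding encodes_def using Gcd_c pos mult by (intro exI[of _ c]) (simp add: c_def)
qed

text \<open>A kernel vector that is nonzero on \<open>B\<close> is a multiple of both candidates. Primitivity forces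
  the two factors to agree up to sign, and positivity at the first index fixes the sign.\<close>

lemma encodes_unique:
  assumes B: "B \<in> bouquets A" and nonfree: "\<not> free_bouquet A B"
    and c: "encodes A B c" and d: "encodes A B d"
  shows "c = d"
proof -
  obtain k u where k: "k \<in> B" and u: "u \<in> mat_kernel A" and uk: "u $ k \<noteq> 0"
    using nonfree by (auto simp: free_bouquet_def)
  obtain m where m: "\<And>i. i \<in> B \<Longrightarrow> u $ i = m * c $ i"
    using c u by (auto simp: encodes_def)
  obtain l where l: "\<And>i. i \<in> B \<Longrightarrow> u $ i = l * d $ i"
    using d u by (auto simp: encodes_def)
  have "finite B" using bouquet_subset[OF B] finite_subset by blast
  then have Min_B: "Min B \<in> B" using k by (intro Min_in) auto
  have eq: "m * c $ i = l * d $ i" if "i \<in> B" for i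
    using m l that by metis
  then have "(\<lambda>i. m * c $ i) ` B = (\<lambda>i. l * d $ i) ` B"
    by (intro image_cong) auto
  then have "\<bar>m\<bar> = \<bar>l\<bar>"
    using Gcd_image_mult[of m "\<lambda>i. c $ i" B] Gcd_image_mult[of l "\<lambda>i. d $ i" B] c d
    by (simp add: encodes_def)
  moreover have "m \<noteq> 0" using m[OF k] uk by auto
  moreover have "m * c $ Min B = l * d $ Min B" "c $ Min B > 0" "d $ Min B > 0"
    using eq[OF Min_B] c d by (auto simp: encodes_def)
  then have "sgn m = sgn l"
    by (metis mult.right_neutral sgn_1_pos sgn_mult)
  ultimately have "m = l" "m \<noteq> 0"
    by (metis abs_sgn mult_sgn_abs)+
  then have on_B: "c $ i = d $ i" if "i \<in> B" for i
    using eq[OF that] by simp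
  show ?thesis
  proof (rule eq_vecI)
    show "dim_vec c = dim_vec d" using c d unfolding encodes_def by (metis carrier_vecD)
    fix i assume "i < dim_vec d"
    then show "c $ i = d $ i"
      using c d on_B[of i] unfolding encodes_def by (cases "i \<in> B") auto
  qed
qed

lemma encodes_bouquet_vec:
  assumes "B \<in> bouquets A" "\<not> free_bouquet A B"
  shows "encodes A B (bouquet_vec A B)"
proof -
  have "bouquet_vec A B = (THE c. encodes A B c)"
    by (simp add: bouquet_vec_def encodes_def)
  moreover obtain c where "encodes A B c"
    using encodes_exists[OF assms] ..
  ultimately show ?thesis
    using theI[of "encodes A B" c] encodes_unique[OF assms] by metis
qed

section \<open>The bouquet bijection\<close>

text \<open>Non-freeness makes every \<open>c i\<close> below a genuine encoding vector; the supports of these vectors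
  partition the columns of \<open>A\<close>.\<close>

locale bouquet_numbering =
  fixes A :: "int mat" and s :: nat and B :: "nat \<Rightarrow> nat set"
  assumes bij: "bij_betw B {..<s} (bouquets A)"
    and nonfree: "\<And>B'. B' \<in> bouquets A \<Longrightarrow> \<not> free_bouquet A B'"
begin

abbreviation c :: "nat \<Rightarrow> int vec" where
  "c i \<equiv> bouquet_vec A (B i)"

abbreviation D :: "int vec \<Rightarrow> int vec" where
  "D \<equiv> bouquet_map A B"

lemma bouquet: "i < s \<Longrightarrow> B i \<in> bouquets A"
  using bij by (auto simp: bij_betw_def)

lemma encodes_c: "i < s \<Longrightarrow> encodes A (B i) (c i)"
  by (simp add: encodes_bouquet_vec bouquet nonfree)

lemma dim_c [simp]: "i < s \<Longrightarrow> dim_vec (c i) = dim_col A"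
  using encodes_c[of i] unfolding encodes_def by auto

lemma bouquet_bound: "i < s \<Longrightarrow> j \<in> B i \<Longrightarrow> j < dim_col A"
  using bouquet_subset[OF bouquet] by blast

lemma c_nonzero_iff: "i < s \<Longrightarrow> j < dim_col A \<Longrightarrow> c i $ j \<noteq> 0 \<longleftrightarrow> j \<in> B i"
  using encodes_c[of i] unfolding encodes_def by blast

lemma bouquet_cover:
  assumes "j < dim_col A" obtains i where "i < s" "j \<in> B i"
proof -
  obtain B' where "B' \<in> bouquets A" "j \<in> B'"
    using assms Union_quotient[OF equiv_bouquet_rel, of A] unfolding bouquets_def by blast
  then show ?thesis using bij that by (auto simp: bij_betw_def)
qed

lemma bouquet_disjoint:
  assumes "i < s" "k < s" "j \<in> B i" "j \<in> B k"
  shows "i = k"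
proof -
  have "B i = B k"
    using quotient_disj[OF equiv_bouquet_rel, of "B i" A "B k"] bouquet[of i] bouquet[of k] assms
    by (auto simp: bouquets_def)
  then show ?thesis using bij assms by (auto simp: bij_betw_def inj_on_def)
qed

lemma Min_bouquet:
  assumes "i < s" shows "Min (B i) \<in> B i"
proof (rule Min_in)
  show "finite (B i)" using bouquet_subset[OF bouquet[OF assms]] finite_subset by blast
  show "B i \<noteq> {}" using nonfree[OF bouquet[OF assms]] by (auto simp: free_bouquet_def)
qed

lemma c_Min_pos: "i < s \<Longrightarrow> c i $ Min (B i) > 0"
  using encodes_c[of i] by (simp add: encodes_def)

lemma non_mixed_iff: "i < s \<Longrightarrow> non_mixed A (B i) \<longleftrightarrow> (\<forall>j\<in>B i. c i $ j > 0)"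
proof -
  assume i: "i < s"
  have "non_mixed A (B i) \<longleftrightarrow> (\<forall>j<dim_col A. c i $ j \<ge> 0)"
    using nonfree[OF bouquet[OF i]] unfolding non_mixed_def mixed_def not_less[symmetric] by blast
  also have "\<dots> \<longleftrightarrow> (\<forall>j\<in>B i. c i $ j > 0)"
    using c_nonzero_iff[OF i] bouquet_bound[OF i] by (metis less_le order_refl)
  finally show ?thesis .
qed

lemma dim_D [simp]: "dim_vec (D u) = dim_col A"
  by (simp add: bouquet_map_def)

text \<open>Since the bouquets are disjoint, only one summand survives at each index.\<close>

lemma D_index:
  assumes u: "u \<in> carrier_vec s" and i: "i < s" and j: "j \<in> B i"
  shows "D u $ j = u $ i * c i $ j"
proof -
  have jn: "j < dim_col A" using bouquet_bound[OF i j] .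
  have "c k $ j = 0" if "k < s" "k \<noteq> i" for k
    using c_nonzero_iff[OF that(1) jn] bouquet_disjoint[OF that(1) i _ j] that(2) by blast
  then have "(\<Sum>k<s. u $ k * c k $ j) = (\<Sum>k\<in>{i}. u $ k * c k $ j)"
    using i by (intro sum.mono_neutral_right) auto
  then show ?thesis using u jn by (simp add: bouquet_map_def)
qed

lemma D_smult: "D (a \<cdot>\<^sub>v u) = a \<cdot>\<^sub>v D u"
  by (rule eq_vecI) (auto simp: bouquet_map_def sum_distrib_left mult.assoc)

text \<open>The columns of the bouquet matrix are the vectors \<open>A *\<^sub>v c i\<close>, so \<open>D\<close> pulls \<open>A\<close> back to it.
  This is what identifies the two kernels.\<close>

lemma mult_D:
  assumes u: "u \<in> carrier_vec s"
  shows "A *\<^sub>v D u = bouquet_matrix A s B *\<^sub>v u"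
proof (rule eq_vecI)
  fix r assume "r < dim_vec (bouquet_matrix A s B *\<^sub>v u)"
  then have r: "r < dim_row A" by (simp add: bouquet_matrix_def)
  have "(A *\<^sub>v D u) $ r = (\<Sum>j<dim_col A. \<Sum>i<s. A $$ (r, j) * (u $ i * c i $ j))"
    using r u by (simp add: scalar_prod_def atLeast0LessThan bouquet_map_def sum_distrib_left)
  also have "\<dots> = (\<Sum>i<s. (\<Sum>j<dim_col A. A $$ (r, j) * c i $ j) * u $ i)"
    by (subst sum.swap) (simp add: sum_distrib_right mult.assoc mult.commute[of "u $ _"])
  also have "\<dots> = (\<Sum>i<s. bouquet_matrix A s B $$ (r, i) * u $ i)"
    by (rule sum.cong)
       (use r in \<open>simp_all add: bouquet_matrix_def mat_of_cols_index scalar_prod_def atLeast0LessThan\<close>)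
  also have "\<dots> = (bouquet_matrix A s B *\<^sub>v u) $ r"
    using r u by (simp add: scalar_prod_def atLeast0LessThan bouquet_matrix_def)
  finally show "(A *\<^sub>v D u) $ r = (bouquet_matrix A s B *\<^sub>v u) $ r" .
qed (simp add: bouquet_matrix_def)

lemma D_in_kernel_iff:
  assumes "u \<in> carrier_vec s"
  shows "D u \<in> mat_kernel A \<longleftrightarrow> u \<in> mat_kernel (bouquet_matrix A s B)"
proof -
  have "D u \<in> carrier_vec (dim_col A)" by (rule carrier_vecI) (rule dim_D)
  moreover have "dim_col (bouquet_matrix A s B) = s" "dim_row (bouquet_matrix A s B) = dim_row A"
    by (simp_all add: bouquet_matrix_def)
  ultimately show ?thesis
    unfolding mat_kernel_def mult_D[OF assms] mem_Collect_eq using assms by simp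
qed

lemma inj_on_D: "inj_on D (carrier_vec s)"
proof (rule inj_onI)
  fix u v assume u: "u \<in> carrier_vec s" and v: "v \<in> carrier_vec s" and eq: "D u = D v"
  show "u = v"
  proof (rule eq_vecI)
    fix i assume "i < dim_vec v"
    then have i: "i < s" using v by simp
    show "u $ i = v $ i"
      using D_index[OF u i Min_bouquet[OF i]] D_index[OF v i Min_bouquet[OF i]] c_Min_pos[OF i] eq
      by simp
  qed (use u v in simp)
qed

text \<open>On each bouquet a kernel vector is a multiple of the encoding vector; the factors are the
  coordinates of a preimage.\<close>

lemma kernel_subset_range_D:
  assumes w: "w \<in> mat_kernel A"
  obtains u where "u \<in> carrier_vec s" "D u = w"
proof -
  have "\<forall>i<s. \<exists>m::int. \<forall>j\<in>B i. w $ j = m * c i $ j"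
    using encodes_c w by (auto simp: encodes_def)
  then obtain m :: "nat \<Rightarrow> int" where m: "\<And>i j. i < s \<Longrightarrow> j \<in> B i \<Longrightarrow> w $ j = m i * c i $ j"
    by metis
  have "D (vec s m) = w"
  proof (rule eq_vecI)
    show "dim_vec (D (vec s m)) = dim_vec w" using w by (auto simp: mat_kernel_def)
    fix j assume "j < dim_vec w"
    then have "j < dim_col A" using w by (auto simp: mat_kernel_def)
    then obtain i where "i < s" "j \<in> B i" by (rule bouquet_cover)
    then show "D (vec s m) $ j = w $ j"
      using D_index[of "vec s m" i j] m by simp
  qed
  then show ?thesis by (intro that[of "vec s m"]) auto
qed

lemma bij_betw_D: "bij_betw D (mat_kernel (bouquet_matrix A s B)) (mat_kernel A)"
proof -
  have K: "mat_kernel (bouquet_matrix A s B) \<subseteq> carrier_vec s"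
    by (auto simp: mat_kernel_def bouquet_matrix_def)
  have "D ` mat_kernel (bouquet_matrix A s B) = mat_kernel A"
  proof
    show "D ` mat_kernel (bouquet_matrix A s B) \<subseteq> mat_kernel A"
      using K D_in_kernel_iff by blast
    show "mat_kernel A \<subseteq> D ` mat_kernel (bouquet_matrix A s B)"
      using kernel_subset_range_D D_in_kernel_iff by (metis image_eqI subsetI)
  qed
  then show ?thesis
    using inj_on_subset[OF inj_on_D K] by (simp add: bij_betw_def)
qed

end

section \<open>Distance reduction\<close>

text \<open>Kernel vectors are orthogonal to the rational row space.\<close>

lemma homogeneous_sum_kernel:
  assumes "homogeneous A" "z \<in> mat_kernel A"
  shows "(\<Sum>j<dim_col A. z $ j) = 0"
proof -
  let ?A = "map_mat rat_of_int A" and ?z = "map_vec rat_of_int z"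
  have z: "z \<in> carrier_vec (dim_col A)" "A *\<^sub>v z = 0\<^sub>v (dim_row A)"
    using assms(2) by (auto simp: mat_kernel_def)
  interpret vec_space "TYPE(rat)" "dim_col A" .
  obtain y where y: "y \<in> carrier_vec (dim_row A)" "?A\<^sup>T *\<^sub>v y = vec (dim_col A) (\<lambda>_. 1)"
    using assms(1) row_space_eq[of ?A "dim_row A"] by (auto simp: homogeneous_def)
  have Az: "?A *\<^sub>v ?z = 0\<^sub>v (dim_row A)"
    using z of_int_hom.mult_mat_vec_hom[of A "dim_row A" "dim_col A" z, where ?'a = rat]
    by (metis carrier_matI of_int_hom.vec_hom_zero)
  have "rat_of_int (\<Sum>j<dim_col A. z $ j) = vec (dim_col A) (\<lambda>_. 1) \<bullet> ?z"
    using z by (simp add: scalar_prod_def atLeast0LessThan)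
  also have "\<dots> = y \<bullet> (?A *\<^sub>v ?z)"
    unfolding y(2)[symmetric]
    by (rule transpose_vec_mult_scalar[of _ "dim_row A" "dim_col A"]) (use z y in auto)
  also have "\<dots> = 0" using y by (simp add: Az)
  finally show ?thesis by (simp only: of_int_eq_0_iff)
qed

lemma pos_part_le_iff:
  "dim_vec v = dim_vec w \<Longrightarrow>
    pos_part v \<le> pos_part w \<longleftrightarrow> (\<forall>j<dim_vec w. max (v $ j) 0 \<le> max (w $ j) 0)"
  by (simp add: less_eq_vec_def pos_part_def)

lemma norm1_smult_sign: "\<delta> \<in> {1, -1} \<Longrightarrow> norm1 (\<delta> \<cdot>\<^sub>v z) = norm1 z"
  by (auto simp: norm1_def abs_mult)

text \<open>Positive and negative parts have the same total when the entries cancel.\<close>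

lemma norm1_sum_zero:
  assumes "(\<Sum>j<dim_vec z. z $ j) = 0"
  shows "norm1 z = 2 * (\<Sum>j<dim_vec z. max (- (z $ j)) 0)"
proof -
  have "norm1 z = (\<Sum>j<dim_vec z. z $ j + 2 * max (- (z $ j)) 0)"
    unfolding norm1_def by (rule sum.cong) (simp_all add: max_def abs_if)
  then show ?thesis using assms by (simp add: sum.distrib sum_distrib_left)
qed

text \<open>The step that removes all sizes from the norm condition. By the previous lemma both norms are
  twice the total of the negative part. Where \<open>z\<close> is positive, \<open>zh \<le> z\<close>, so \<open>z - zh\<close> has no
  negative part; elsewhere \<open>zh\<close> is at most 0, and the negative part of \<open>z - zh\<close> is at most that
  of \<open>z\<close>, being strictly smaller exactly if \<open>z\<close> and \<open>zh\<close> are both negative. Hence the norm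
  drops if and only if this happens at some index.\<close>

lemma norm1_diff_less_iff:
  assumes dim: "dim_vec zh = dim_vec z"
    and sums: "(\<Sum>j<dim_vec z. z $ j) = 0" "(\<Sum>j<dim_vec z. zh $ j) = 0"
    and le: "pos_part zh \<le> pos_part z"
  shows "norm1 (z - zh) < norm1 z \<longleftrightarrow> (\<exists>j<dim_vec z. z $ j < 0 \<and> zh $ j < 0)"
proof -
  let ?n = "dim_vec z"
  let ?a = "\<lambda>j. max (zh $ j - z $ j) 0" and ?b = "\<lambda>j. max (- (z $ j)) 0"
  have "norm1 (z - zh) = 2 * (\<Sum>j<?n. ?a j)"
    using norm1_sum_zero[of "z - zh"] sums dim by (simp add: sum_subtractf)
  moreover have "norm1 z = 2 * (\<Sum>j<?n. ?b j)"
    by (rule norm1_sum_zero[OF sums(1)])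
  moreover have pw: "?a j \<le> ?b j" "?a j < ?b j \<longleftrightarrow> z $ j < 0 \<and> zh $ j < 0" if "j < ?n" for j
  proof -
    have "max (zh $ j) 0 \<le> max (z $ j) 0"
      using le that by (simp add: pos_part_le_iff[OF dim])
    then show "?a j \<le> ?b j" "?a j < ?b j \<longleftrightarrow> z $ j < 0 \<and> zh $ j < 0"
      by (auto simp: max_def split: if_splits)
  qed
  have "(\<Sum>j<?n. ?a j) < (\<Sum>j<?n. ?b j) \<longleftrightarrow> (\<exists>j<?n. ?a j < ?b j)"
  proof
    assume less: "(\<Sum>j<?n. ?a j) < (\<Sum>j<?n. ?b j)"
    show "\<exists>j<?n. ?a j < ?b j"
    proof (rule ccontr)
      assume "\<not> (\<exists>j<?n. ?a j < ?b j)"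
      then have "(\<Sum>j<?n. ?b j) \<le> (\<Sum>j<?n. ?a j)"
        by (intro sum_mono) (meson lessThan_iff not_less)
      with less show False by simp
    qed
  next
    assume "\<exists>j<?n. ?a j < ?b j"
    then show "(\<Sum>j<?n. ?a j) < (\<Sum>j<?n. ?b j)"
      using pw(1) by (intro sum_strict_mono_ex1) auto
  qed
  ultimately show ?thesis using pw(2) by auto
qed

text \<open>The condition on kernel vectors \<open>D v\<close>, \<open>D u\<close>, with signs already chosen, that \<open>D v\<close>
  distance-reduces \<open>D u\<close>, expressed in bouquet coordinates. A non-mixed bouquet only compares
  the signs of \<open>v\<close> and \<open>u\<close> as they are, while a mixed one also has a negative entry, which
  repeats the comparison with both signs flipped. The vectors \<open>c i\<close> do not occur.\<close>

definition reduces_coordinates :: "nat \<Rightarrow> nat set \<Rightarrow> int vec \<Rightarrow> int vec \<Rightarrow> bool" where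
  "reduces_coordinates s \<omega> v u \<longleftrightarrow>
     (\<forall>i<s. max (v $ i) 0 \<le> max (u $ i) 0 \<and>
            (i \<notin> \<omega> \<longrightarrow> max (- (v $ i)) 0 \<le> max (- (u $ i)) 0)) \<and>
     (\<exists>i<s. u $ i < 0 \<and> v $ i < 0 \<or> i \<notin> \<omega> \<and> u $ i > 0 \<and> v $ i > 0)"

lemma max_mult_le_iff:
  fixes c x y :: int
  shows "c > 0 \<Longrightarrow> max (x * c) 0 \<le> max (y * c) 0 \<longleftrightarrow> max x 0 \<le> max y 0"
    and "c < 0 \<Longrightarrow> max (x * c) 0 \<le> max (y * c) 0 \<longleftrightarrow> max (- x) 0 \<le> max (- y) 0"
proof -
  have *: "max (x * c) 0 \<le> max (y * c) 0 \<longleftrightarrow> max x 0 \<le> max y 0" if "c > 0" for c x y :: int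
  proof -
    have "max (x * c) 0 = max x 0 * c" "max (y * c) 0 = max y 0 * c"
      using that max_mult_distrib_right[of x 0 c] max_mult_distrib_right[of y 0 c] by simp_all
    then show ?thesis using that by simp
  qed
  show "c > 0 \<Longrightarrow> max (x * c) 0 \<le> max (y * c) 0 \<longleftrightarrow> max x 0 \<le> max y 0"
    by (rule *)
  show "c < 0 \<Longrightarrow> max (x * c) 0 \<le> max (y * c) 0 \<longleftrightarrow> max (- x) 0 \<le> max (- y) 0"
    using *[of "- c" "- x" "- y"] by simp
qed

context bouquet_numbering
begin

text \<open>At an index of the bouquet \<open>B i\<close> both vectors are multiples of the same nonzero entry of
  \<open>c i\<close>. Comparing their positive parts, or asking both to be negative, therefore depends only
  on the sign of that entry. Positive entries occur in every bouquet, negative ones exactly in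
  the mixed bouquets.\<close>

lemma reduces_D_iff:
  assumes u: "u \<in> carrier_vec s" and v: "v \<in> carrier_vec s"
    and sums: "(\<Sum>j<dim_col A. D u $ j) = 0" "(\<Sum>j<dim_col A. D v $ j) = 0"
    and \<omega>: "\<omega> = {i. i < s \<and> non_mixed A (B i)}"
  shows "pos_part (D v) \<le> pos_part (D u) \<and> norm1 (D u - D v) < norm1 (D u)
    \<longleftrightarrow> reduces_coordinates s \<omega> v u"
proof -
  have neg_entry: "\<exists>j\<in>B i. c i $ j < 0" if i: "i < s" "i \<notin> \<omega>" for i
  proof -
    obtain j where "j \<in> B i" "\<not> c i $ j > 0"
      using i non_mixed_iff[OF i(1)] by (auto simp: \<omega>)
    moreover from this have "c i $ j \<noteq> 0"
      using i(1) c_nonzero_iff bouquet_bound by blast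
    ultimately show ?thesis by (intro bexI[of _ j]) auto
  qed
  have pos_entry: "\<exists>j\<in>B i. c i $ j > 0" if "i < s" for i
    using Min_bouquet[OF that] c_Min_pos[OF that] by blast
  have entry: "c i $ j > 0 \<or> c i $ j < 0 \<and> i \<notin> \<omega>" if "i < s" "j \<in> B i" for i j
    using that non_mixed_iff[of i] c_nonzero_iff[of i j] bouquet_bound[of i j] by (auto simp: \<omega>)
  have cover: "\<exists>i<s. j \<in> B i" if "j < dim_col A" for j
    using bouquet_cover[OF that] by blast
  have all_iff: "(\<forall>j<dim_col A. P j) \<longleftrightarrow> (\<forall>i<s. \<forall>j\<in>B i. P j)" for P
    using cover bouquet_bound by blast
  have ex_iff: "(\<exists>j<dim_col A. P j) \<longleftrightarrow> (\<exists>i<s. \<exists>j\<in>B i. P j)" for P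
    using cover bouquet_bound by blast
  have le: "pos_part (D v) \<le> pos_part (D u) \<longleftrightarrow>
      (\<forall>i<s. max (v $ i) 0 \<le> max (u $ i) 0 \<and>
            (i \<notin> \<omega> \<longrightarrow> max (- (v $ i)) 0 \<le> max (- (u $ i)) 0))" (is "_ \<longleftrightarrow> (\<forall>i<s. ?Q i)")
  proof -
    have "pos_part (D v) \<le> pos_part (D u) \<longleftrightarrow>
        (\<forall>i<s. \<forall>j\<in>B i. max (v $ i * c i $ j) 0 \<le> max (u $ i * c i $ j) 0)"
      by (simp add: pos_part_le_iff all_iff D_index[OF u] D_index[OF v])
    also have "\<dots> \<longleftrightarrow> (\<forall>i<s. ?Q i)"
    proof -
      have "(\<forall>j\<in>B i. max (v $ i * c i $ j) 0 \<le> max (u $ i * c i $ j) 0) \<longleftrightarrow> ?Q i" if i: "i < s" for i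
      proof
        assume *: "\<forall>j\<in>B i. max (v $ i * c i $ j) 0 \<le> max (u $ i * c i $ j) 0"
        show "?Q i"
        proof (intro conjI impI)
          obtain j where "j \<in> B i" "c i $ j > 0" using pos_entry[OF i] by blast
          then show "max (v $ i) 0 \<le> max (u $ i) 0"
            using * max_mult_le_iff(1) by blast
        next
          assume "i \<notin> \<omega>"
          then obtain j where "j \<in> B i" "c i $ j < 0" using neg_entry[OF i] by blast
          then show "max (- (v $ i)) 0 \<le> max (- (u $ i)) 0"
            using * max_mult_le_iff(2) by blast
        qed
      next
        assume Q: "?Q i"
        show "\<forall>j\<in>B i. max (v $ i * c i $ j) 0 \<le> max (u $ i * c i $ j) 0"
        proof
          fix j assume "j \<in> B i"
          from entry[OF i this] show "max (v $ i * c i $ j) 0 \<le> max (u $ i * c i $ j) 0"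
            using Q max_mult_le_iff by blast
        qed
      qed
      then show ?thesis by blast
    qed
    finally show ?thesis .
  qed
  have neg: "(\<exists>j<dim_col A. D u $ j < 0 \<and> D v $ j < 0) \<longleftrightarrow>
      (\<exists>i<s. u $ i < 0 \<and> v $ i < 0 \<or> i \<notin> \<omega> \<and> u $ i > 0 \<and> v $ i > 0)" (is "_ \<longleftrightarrow> (\<exists>i<s. ?Q i)")
  proof -
    have "(\<exists>j<dim_col A. D u $ j < 0 \<and> D v $ j < 0) \<longleftrightarrow>
        (\<exists>i<s. \<exists>j\<in>B i. D u $ j < 0 \<and> D v $ j < 0)"
      by (rule ex_iff)
    also have "\<dots> \<longleftrightarrow> (\<exists>i<s. ?Q i)"
    proof -
      have "(\<exists>j\<in>B i. D u $ j < 0 \<and> D v $ j < 0) \<longleftrightarrow> ?Q i" if i: "i < s" for i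
      proof -
        have 1: "(\<exists>j\<in>B i. D u $ j < 0 \<and> D v $ j < 0) \<longleftrightarrow>
            (\<exists>j\<in>B i. c i $ j > 0 \<and> u $ i < 0 \<and> v $ i < 0 \<or> c i $ j < 0 \<and> u $ i > 0 \<and> v $ i > 0)"
          by (intro bex_cong refl) (auto simp: D_index[OF u i] D_index[OF v i] mult_less_0_iff)
        show ?thesis
          unfolding 1
        proof
          assume "\<exists>j\<in>B i. c i $ j > 0 \<and> u $ i < 0 \<and> v $ i < 0 \<or> c i $ j < 0 \<and> u $ i > 0 \<and> v $ i > 0"
          then obtain j where j: "j \<in> B i"
            "c i $ j > 0 \<and> u $ i < 0 \<and> v $ i < 0 \<or> c i $ j < 0 \<and> u $ i > 0 \<and> v $ i > 0" ..
          then show "?Q i" using entry[OF i j(1)] by auto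
        next
          assume "?Q i"
          then show "\<exists>j\<in>B i. c i $ j > 0 \<and> u $ i < 0 \<and> v $ i < 0 \<or> c i $ j < 0 \<and> u $ i > 0 \<and> v $ i > 0"
          proof
            assume "u $ i < 0 \<and> v $ i < 0"
            then show ?thesis using pos_entry[OF i] by blast
          next
            assume "i \<notin> \<omega> \<and> u $ i > 0 \<and> v $ i > 0"
            then show ?thesis using neg_entry[OF i] by blast
          qed
        qed
      qed
      then show ?thesis by blast
    qed
    finally show ?thesis .
  qed
  show ?thesis
    unfolding reduces_coordinates_def le[symmetric] neg[symmetric]
    using norm1_diff_less_iff[of "D v" "D u", unfolded dim_D, OF refl sums] by blast
qed

lemma distance_reduced_by_D_iff:
  assumes hom: "homogeneous A"
    and u: "u \<in> mat_kernel (bouquet_matrix A s B)" and v: "v \<in> mat_kernel (bouquet_matrix A s B)"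
    and \<omega>: "\<omega> = {i. i < s \<and> non_mixed A (B i)}"
  shows "distance_reduced_by (D u) (D v) \<longleftrightarrow>
    (\<exists>\<epsilon>\<in>{1, -1}. \<exists>\<delta>\<in>{1, -1}. reduces_coordinates s \<omega> (\<epsilon> \<cdot>\<^sub>v v) (\<delta> \<cdot>\<^sub>v u))"
proof -
  have carrier: "u \<in> carrier_vec s" "v \<in> carrier_vec s"
    using u v by (auto simp: mat_kernel_def bouquet_matrix_def)
  have sum: "(\<Sum>j<dim_col A. D (a \<cdot>\<^sub>v w) $ j) = 0"
    if "w \<in> mat_kernel (bouquet_matrix A s B)" for a w
  proof -
    have "D w \<in> mat_kernel A" using that bij_betw_D by (auto simp: bij_betw_def)
    then show ?thesis
      using homogeneous_sum_kernel[OF hom, of "D w"] by (simp add: D_smult flip: sum_distrib_left)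
  qed
  have "pos_part (\<epsilon> \<cdot>\<^sub>v D v) \<le> pos_part (\<delta> \<cdot>\<^sub>v D u) \<and> norm1 (\<delta> \<cdot>\<^sub>v D u - \<epsilon> \<cdot>\<^sub>v D v) < norm1 (D u)
      \<longleftrightarrow> reduces_coordinates s \<omega> (\<epsilon> \<cdot>\<^sub>v v) (\<delta> \<cdot>\<^sub>v u)" if "\<delta> \<in> {1, -1}" for \<epsilon> \<delta>
    using reduces_D_iff[OF _ _ sum[OF u] sum[OF v] \<omega>, of \<delta> \<epsilon>] carrier norm1_smult_sign[OF that, of "D u"]
    by (simp add: D_smult)
  then show ?thesis
    unfolding distance_reduced_by_def by (intro bex_cong refl)
qed

end

lemma robust_imp_kernel_eq:
  assumes "robust TYPE('k::field) T \<omega> A B"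
  shows "mat_kernel (bouquet_matrix A (dim_col T) B) = mat_kernel T"
  by (rule toric_ideal_eq_imp_mat_kernel_eq[where ?'k = 'k])
     (use assms in \<open>auto simp: robust_def bouquet_matrix_def\<close>)

theorem theorem4p9:
  fixes T A\<^sub>1 A\<^sub>2 :: "int mat" and \<omega> :: "nat set" and B\<^sub>1 B\<^sub>2 :: "nat \<Rightarrow> nat set"
    and D\<^sub>1 D\<^sub>2 \<phi> :: "int vec \<Rightarrow> int vec"
  assumes "pointed T" and "simple_toric T" and "\<omega> \<subseteq> {..<dim_col T}"
    and "pointed A\<^sub>1" and "homogeneous A\<^sub>1" and "\<forall>B \<in> bouquets A\<^sub>1. \<not> free_bouquet A\<^sub>1 B"
    and "robust TYPE('k::field) T \<omega> A\<^sub>1 B\<^sub>1"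
    and "pointed A\<^sub>2" and "homogeneous A\<^sub>2" and "\<forall>B \<in> bouquets A\<^sub>2. \<not> free_bouquet A\<^sub>2 B"
    and "robust TYPE('k) T \<omega> A\<^sub>2 B\<^sub>2"
  defines "D\<^sub>1 \<equiv> bouquet_map A\<^sub>1 B\<^sub>1" and "D\<^sub>2 \<equiv> bouquet_map A\<^sub>2 B\<^sub>2"
    and "\<phi> \<equiv> D\<^sub>2 \<circ> the_inv_into (mat_kernel T) D\<^sub>1"
  shows "\<forall>zh \<in> mat_kernel A\<^sub>1. \<forall>z \<in> mat_kernel A\<^sub>1.
           distance_reduced_by z zh \<longleftrightarrow> distance_reduced_by (\<phi> z) (\<phi> zh)"
proof -
  interpret N1: bouquet_numbering A\<^sub>1 "dim_col T" B\<^sub>1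
    by unfold_locales (use assms(6,7) in \<open>auto simp: robust_def\<close>)
  interpret N2: bouquet_numbering A\<^sub>2 "dim_col T" B\<^sub>2
    by unfold_locales (use assms(10,11) in \<open>auto simp: robust_def\<close>)
  note K1 = robust_imp_kernel_eq[OF assms(7)] and K2 = robust_imp_kernel_eq[OF assms(11)]
  have \<omega>1: "\<omega> = {i. i < dim_col T \<and> non_mixed A\<^sub>1 (B\<^sub>1 i)}"
    and \<omega>2: "\<omega> = {i. i < dim_col T \<and> non_mixed A\<^sub>2 (B\<^sub>2 i)}"
    using assms(7,11) by (auto simp: robust_def)
  have bij1: "bij_betw D\<^sub>1 (mat_kernel T) (mat_kernel A\<^sub>1)"
    using N1.bij_betw_D unfolding K1 D\<^sub>1_def .
  have \<phi>: "\<phi> (D\<^sub>1 u) = D\<^sub>2 u" if "u \<in> mat_kernel T" for u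
    using that bij1 by (simp add: \<phi>_def the_inv_into_f_f bij_betw_def)
  have "distance_reduced_by (D\<^sub>1 u) (D\<^sub>1 v) \<longleftrightarrow> distance_reduced_by (D\<^sub>2 u) (D\<^sub>2 v)"
    if "u \<in> mat_kernel T" "v \<in> mat_kernel T" for u v
    using N1.distance_reduced_by_D_iff[OF assms(5) _ _ \<omega>1, of u v]
      N2.distance_reduced_by_D_iff[OF assms(9) _ _ \<omega>2, of u v] that
    unfolding K1 K2 D\<^sub>1_def D\<^sub>2_def by blast
  then have "distance_reduced_by (D\<^sub>1 u) (D\<^sub>1 v) \<longleftrightarrow> distance_reduced_by (\<phi> (D\<^sub>1 u)) (\<phi> (D\<^sub>1 v))"
    if "u \<in> mat_kernel T" "v \<in> mat_kernel T" for u v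
    using that by (simp add: \<phi>)
  then show ?thesis
    unfolding bij_betw_imp_surj_on[OF bij1, symmetric] by blast
qed

end
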